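(* Let $I\subset\mathbb{R}$ be a nonempty open interval and $\{P_t:t\in I\}$ the exponential family described in the context, with log-partition function $\Lambda$. Let $\beta\in\mathbb{R}^p$ and let $y_1,\ldots,y_n$ be independent with $y_i\sim P_{t_i}$, $t_i=X_i^\top\beta$. Put $\epsilon_i=y_i-\Lambda'(X_i^\top\beta)$. Suppose $\epsilon_1,\ldots,\epsilon_n$ satisfy the tail assumption for some $\sigma>0$: for all $t,a_1,\ldots,a_n\in\mathbb{R}$, $$\Pr\Big\{\Big(\sum_{i=1}^n a_i\epsilon_i\Big)^2>t^2\sum_{i=1}^n a_i^2\Big\}\le 2\exp\{-t^2/(2\sigma^2)\}.$$ Fix $\nu\in(0,1)$ and let $$D=\{u\in\mathbb{R}^p:\ X_i^\top u\in I \text{ for } 1\le i\le n,\ |\mathrm{spt}(u)|\le \mathsf{n}(\nu)/2\}.$$ Suppose $\delta:=\inf_{t\in I}\Lambda''(t)>0$. Fix $q\in(0,1/2)$, let $$c_r=\frac{3\sigma^2\ln(p/q)}{\nu\delta[1+\mu(X)]}\,\frac{\max_j\|V_j\|_2^2}{\min_j\|V_j\|_2^2},$$ and let $\widehat\beta$ be the $L_0$ regularized maximum likelihood estimator $$\widehat\beta=\arg\max_{u\in D}\Big[y^\top Xu-\sum_{i=1}^n\Lambda(X_i^\top u)-c_r|\mathrm{spt}(u)|\Big].$$ Then, provided $\beta\in D$, $$\Pr\Big\{\|\widehat\beta-\beta\|_2\le\frac{\kappa_r\sqrt{|\mathrm{spt}(\beta)|}}{\sqrt n}\Big\}\ge 1-2q,\qquad\text{where}\quad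 \kappa_r=\frac{3\sigma\sqrt{2\ln(p/q)}}{\nu\delta[1+\mu(X)]}\times\frac{\sqrt n\,\max_j\|V_j\|_2}{\min_j\|V_j\|_2^2}.$$
   Context: $X$ is a fixed real $n\times p$ matrix with rows $X_1^\top,\ldots,X_n^\top$ ($X_i\in\mathbb{R}^p$) and columns $V_1,\ldots,V_p\in\mathbb{R}^n$, all $V_j\neq0$. $\mathrm{spt}(u)=\{i:u_i\neq0\}$, $|\cdot|$ of a set is its cardinality, $\|\cdot\|_2$ is the Euclidean norm. $$\mu(X)=\sup_{1\le i<j\le p}\frac{|V_i^\top V_j|}{\|V_i\|_2\|V_j\|_2},\qquad \mathsf{n}(\nu)=(1-\nu)[1+1/\mu(X)],$$ with $\mathsf n(\nu)$ understood as $+\infty$ if $\mu(X)=0$. Exponential family: $m$ is a Borel measure on $\mathbb{R}$ with $m(\mathbb{R})>0$, $I$ is a nonempty open interval, and for each $t\in I$, $P_t$ is a probability distribution on $\mathbb{R}$ with density $p_t(y)=\exp\{ty-\Lambda(t)\}$ with respect to $m$, where $\Lambda(t)=\ln\big[\int e^{ty}\,m(dy)\big]$ (so $\Lambda\in C^\infty(I)$, and $P_t$ has mean $\Lambda'(t)$ and variance $\Lambda''(t)$). $\widehat\beta$ denotes a (random) element of $D$ attaining the maximum. *)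

theory Defs
  imports "HOL-Probability.Probability"
begin

definition spt :: "real ^ 'p::finite \<Rightarrow> 'p set" where
  "spt u = {j. u $ j \<noteq> 0}"

text \<open>The supremum is taken in the nonnegative reals: inserting \<open>0\<close> changes nothing
  when there are at least two columns and gives the value \<open>0\<close> when there is only one.\<close>

definition coherence :: "real ^ 'p::finite ^ 'n::finite \<Rightarrow> real" where
  "coherence X = Sup (insert 0 {\<bar>column i X \<bullet> column j X\<bar> / (norm (column i X) * norm (column j X)) | i j. i \<noteq> j})"

definition sparsity_bound :: "real ^ 'p::finite ^ 'n::finite \<Rightarrow> real \<Rightarrow> ereal" where
  "sparsity_bound X \<nu> =
     (if coherence X = 0 then \<infinity> else ereal ((1 - \<nu>) * (1 + 1 / coherence X)))"

definition sparse_domain :: "real ^ 'p::finite ^ 'n::finite \<Rightarrow> real set \<Rightarrow> real \<Rightarrow> (real ^ 'p) set" where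
  "sparse_domain X I \<nu> =
     {u. (\<forall>i. row i X \<bullet> u \<in> I) \<and> ereal (real (card (spt u))) \<le> sparsity_bound X \<nu> / 2}"

definition log_partition :: "real measure \<Rightarrow> real \<Rightarrow> real" where
  "log_partition m t = ln (\<integral>y. exp (t * y) \<partial>m)"

definition exp_family_dist :: "real measure \<Rightarrow> real \<Rightarrow> real measure" where
  "exp_family_dist m t = density m (\<lambda>y. ennreal (exp (t * y - log_partition m t)))"

text \<open>If \<open>y \<mapsto> exp (t * y)\<close> is not integrable, its Bochner integral is \<open>0\<close>, so
  \<open>log_partition m t\<close> is \<open>ln 0 = 0\<close> and the density has infinite mass. Hence the
  last conjunct also says that the log-partition function is finite on \<open>I\<close>.\<close>

definition exponential_family :: "real measure \<Rightarrow> real set \<Rightarrow> bool" where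
  "exponential_family m I \<longleftrightarrow>
     sets m = sets borel \<and> emeasure m UNIV > 0 \<and>
     open I \<and> is_interval I \<and> I \<noteq> {} \<and>
     (\<forall>t\<in>I. prob_space (exp_family_dist m t))"

definition penalized_loglik ::
    "real measure \<Rightarrow> real ^ 'p::finite ^ 'n::finite \<Rightarrow> real \<Rightarrow> real ^ 'n \<Rightarrow> real ^ 'p \<Rightarrow> real" where
  "penalized_loglik m X c y u =
     y \<bullet> (X *v u) - (\<Sum>i\<in>UNIV. log_partition m (row i X \<bullet> u)) - c * real (card (spt u))"

end

theory Submission
  imports Defs
begin

text \<open>
  Since \<open>\<Lambda>'' \<ge> \<delta>\<close>, comparing the penalized likelihood at the maximizer and at \<open>\<beta>\<close> gives, for
  \<open>h = \<beta>hat - \<beta>\<close>, the inequality \<open>\<epsilon>\<^sup>T X h - \<delta> / 2 * \<parallel>X h\<parallel>\<^sup>2 \<ge> c_r (|spt \<beta>hat| - |spt \<beta>|)\<close>.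
  Here \<open>\<parallel>X h\<parallel>\<^sup>2 \<ge> \<nu> (1 + \<mu>) (min \<parallel>V\<^sub>j\<parallel>\<^sup>2) \<parallel>h\<parallel>\<^sup>2\<close> because \<open>h\<close> has at most \<open>n(\<nu>)\<close> nonzero entries,
  while on the event \<open>\<forall>j. |V\<^sub>j\<^sup>T \<epsilon>| \<le> \<sigma> sqrt (2 ln (p / q)) \<parallel>V\<^sub>j\<parallel>\<close>, whose complement has probability at
  most \<open>2 q\<close> by a union bound, the noise term is at most a multiple of \<open>sqrt |spt h| * \<parallel>h\<parallel>\<close>.
  Bounding \<open>|spt h|\<close> by \<open>|spt \<beta>hat| + |spt \<beta>|\<close> and completing the square, the penalty
  absorbs \<open>|spt \<beta>hat|\<close>.
\<close>

section \<open>Smoothness and strong convexity of the log-partition function\<close>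

text \<open>Subtracting the parabola \<open>\<delta> / 2 * x\<^sup>2\<close> leaves a function with
  nonnegative second derivative; the claim is the tangent inequality for that function.\<close>

lemma strong_convexity_lower_bound:
  fixes f :: "real \<Rightarrow> real"
  assumes "convex C"
    and f': "\<And>x. x \<in> C \<Longrightarrow> DERIV f x :> f' x"
    and f'': "\<And>x. x \<in> C \<Longrightarrow> DERIV f' x :> f'' x"
    and ge: "\<And>x. x \<in> C \<Longrightarrow> f'' x \<ge> \<delta>"
    and "x \<in> C" "y \<in> C"
  shows "f y - f x \<ge> f' x * (y - x) + \<delta> / 2 * (y - x)\<^sup>2"
proof -
  let ?g = "\<lambda>x. f x - \<delta> / 2 * x\<^sup>2"
  have "(f' x - \<delta> * x) * (y - x) \<le> ?g y - ?g x"
  proof (rule f''_imp_f'[of C ?g "\<lambda>x. f' x - \<delta> * x" "\<lambda>x. f'' x - \<delta>"])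
    show "DERIV ?g x :> f' x - \<delta> * x" if "x \<in> C" for x
      by (auto intro!: derivative_eq_intros f' that)
    show "DERIV (\<lambda>x. f' x - \<delta> * x) x :> f'' x - \<delta>" if "x \<in> C" for x
      by (auto intro!: derivative_eq_intros f'' that)
  qed (use assms in auto)
  then show ?thesis by (simp add: algebra_simps power2_eq_square)
qed

text \<open>The series of absolute values of the terms is dominated by the sum of the exponentials
  at the two endpoints \<open>t - r\<close> and \<open>t + r\<close>, so sum and integral may be
  interchanged.\<close>

lemma laplace_transform_power_series:
  fixes m :: "real measure" and t h r :: real
  assumes [measurable_cong]: "sets m = sets borel"
    and int: "integrable m (\<lambda>y. exp ((t - r) * y))" "integrable m (\<lambda>y. exp ((t + r) * y))"
    and h: "\<bar>h\<bar> \<le> r"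
  shows "integrable m (\<lambda>y. (h * y) ^ k /\<^sub>R fact k * exp (t * y))" (is "integrable m (?f k)")
    and "(\<lambda>k. (\<integral>y. y ^ k /\<^sub>R fact k * exp (t * y) \<partial>m) * h ^ k) sums (\<integral>y. exp ((t + h) * y) \<partial>m)"
proof -
  let ?g = "\<lambda>y. exp (\<bar>h * y\<bar>) * exp (t * y)"
  have g_le: "?g y \<le> exp ((t - r) * y) + exp ((t + r) * y)" for y
  proof -
    have "\<bar>h * y\<bar> \<le> r * \<bar>y\<bar>" using h by (simp add: abs_mult mult_right_mono)
    hence "?g y \<le> exp (r * \<bar>y\<bar> + t * y)" by (simp add: exp_add)
    also have "\<dots> \<le> exp ((t - r) * y) + exp ((t + r) * y)"
      by (cases "y \<ge> 0") (simp_all add: algebra_simps add_increasing add_increasing2)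
    finally show ?thesis .
  qed
  have int_g: "integrable m ?g"
    by (rule Bochner_Integration.integrable_bound[OF Bochner_Integration.integrable_add[OF int]])
       (auto intro!: AE_I2 order.trans[OF g_le])
  have norm_f: "norm (?f k y) = \<bar>h * y\<bar> ^ k /\<^sub>R fact k * exp (t * y)" for k y
    by (simp add: abs_mult power_abs)
  have sums_norm: "(\<lambda>k. norm (?f k y)) sums ?g y" for y
    unfolding norm_f by (intro sums_mult2 exp_converges)
  \<comment> \<open>Used twice: a singleton \<open>F\<close> gives integrability of one term, an
    initial segment gives summability of the integrated norms.\<close>
  have partial: "(\<Sum>k\<in>F. norm (?f k y)) \<le> ?g y" if "finite F" for F y
    using sum_le_suminf[OF sums_summable[OF sums_norm] that] sums_unique[OF sums_norm] by simp
  have int_f: "integrable m (?f k)" for k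
    by (rule Bochner_Integration.integrable_bound[OF int_g])
       (use partial[of "{k}" for k] in \<open>auto intro!: AE_I2\<close>)
  then show "integrable m (?f k)" .
  have "summable (\<lambda>k. \<integral>y. norm (?f k y) \<partial>m)"
  proof (rule summableI_nonneg_bounded)
    fix n
    have "(\<Sum>k<n. \<integral>y. norm (?f k y) \<partial>m) = (\<integral>y. (\<Sum>k<n. norm (?f k y)) \<partial>m)"
      by (intro Bochner_Integration.integral_sum[symmetric] integrable_norm int_f)
    also have "\<dots> \<le> (\<integral>y. ?g y \<partial>m)"
      by (intro integral_mono Bochner_Integration.integrable_sum integrable_norm int_f int_g partial) simp
    finally show "(\<Sum>k<n. \<integral>y. norm (?f k y) \<partial>m) \<le> (\<integral>y. ?g y \<partial>m)" .
  qed simp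
  moreover have "AE y in m. summable (\<lambda>k. norm (?f k y))"
    using sums_summable[OF sums_norm] by simp
  ultimately have "(\<lambda>k. \<integral>y. ?f k y \<partial>m) sums (\<integral>y. (\<Sum>k. ?f k y) \<partial>m)"
    using int_f by (intro sums_integral)
  moreover have "(\<Sum>k. ?f k y) = exp ((t + h) * y)" for y
    using sums_unique[OF sums_mult2[OF exp_converges[of "h * y"], of "exp (t * y)"]]
    by (simp add: algebra_simps exp_add)
  moreover have "(\<integral>y. ?f k y \<partial>m) = (\<integral>y. y ^ k /\<^sub>R fact k * exp (t * y) \<partial>m) * h ^ k" for k
    by (subst integral_mult_left_zero[symmetric]) (simp add: power_mult_distrib mult_ac)
  ultimately show "(\<lambda>k. (\<integral>y. y ^ k /\<^sub>R fact k * exp (t * y) \<partial>m) * h ^ k) sums (\<integral>y. exp ((t + h) * y) \<partial>m)"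
    by simp
qed

text \<open>Differentiating the local power series termwise avoids differentiation under the integral
  sign: the first two derivatives at \<open>t\<close> are read off from the coefficients at the center \<open>t\<close>.\<close>

lemma laplace_transform_derivatives:
  fixes m :: "real measure" and I :: "real set"
  assumes sets: "sets m = sets borel" and "open I"
    and int: "\<And>t. t \<in> I \<Longrightarrow> integrable m (\<lambda>y. exp (t * y))"
    and "t \<in> I"
  shows "integrable m (\<lambda>y. y ^ k * exp (t * y))"
    and "DERIV (\<lambda>t. \<integral>y. exp (t * y) \<partial>m) t :> (\<integral>y. y * exp (t * y) \<partial>m)"
    and "DERIV (\<lambda>t. \<integral>y. y * exp (t * y) \<partial>m) t :> (\<integral>y. y\<^sup>2 * exp (t * y) \<partial>m)"
proof -
  let ?Z = "\<lambda>t. \<integral>y. exp (t * y) \<partial>m"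
  let ?a = "\<lambda>t k. \<integral>y. y ^ k /\<^sub>R fact k * exp (t * y) \<partial>m"
  have radius: "\<exists>r>0. ball t r \<subseteq> I \<and> integrable m (\<lambda>y. exp ((t - r) * y)) \<and> integrable m (\<lambda>y. exp ((t + r) * y))"
    if t: "t \<in> I" for t
  proof -
    obtain r where "r > 0" "cball t r \<subseteq> I" using \<open>open I\<close> t unfolding open_contains_cball by blast
    moreover from this have "t - r \<in> I" "t + r \<in> I" by (auto simp: dist_real_def)
    ultimately show ?thesis using int by (intro exI[of _ r]) auto
  qed
  \<comment> \<open>The series stays centered at \<open>t\<close> while \<open>s\<close> ranges over
    the whole ball: a second differentiation needs the first derivative on a neighbourhood.\<close>
  have local_series: "DERIV ?Z s :> (\<Sum>n. diffs (?a t) n * (s - t) ^ n)"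
    "DERIV (\<lambda>s. \<Sum>n. diffs (?a t) n * (s - t) ^ n) s :> (\<Sum>n. diffs (diffs (?a t)) n * (s - t) ^ n)"
    if "t \<in> I" "r > 0" "s \<in> ball t r" 
      "integrable m (\<lambda>y. exp ((t - r) * y))" "integrable m (\<lambda>y. exp ((t + r) * y))" for t r s
  proof -
    have sums: "(\<lambda>n. ?a t n * h ^ n) sums ?Z (t + h)" if "\<bar>h\<bar> < r" for h
      using laplace_transform_power_series(2)[OF sets \<open>integrable m (\<lambda>y. exp ((t - r) * y))\<close> 
          \<open>integrable m (\<lambda>y. exp ((t + r) * y))\<close>, of h] that by simp
    have summable0: "summable (\<lambda>n. ?a t n * h ^ n)" if "norm h < r" for h
      using sums_summable[OF sums] that by simp
    have summable1: "summable (\<lambda>n. diffs (?a t) n * h ^ n)" if "norm h < r" for h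
      using termdiff_converges[OF that summable0] by simp
    have st: "norm (s - t) < r" using that by (simp add: dist_real_def abs_minus_commute)
    have shift: "DERIV (\<lambda>s. s - t) s :> 1" by (auto intro!: derivative_eq_intros)
    have "DERIV (\<lambda>s. \<Sum>n. ?a t n * (s - t) ^ n) s :> (\<Sum>n. diffs (?a t) n * (s - t) ^ n)"
      using DERIV_chain'[OF shift termdiffs_strong'[of r "?a t", OF summable0 st]] by simp
    moreover have "(\<Sum>n. ?a t n * (s - t) ^ n) = ?Z s" if "s \<in> ball t r" for s
      using sums_unique[OF sums[of "s - t"]] that by (simp add: dist_real_def abs_minus_commute)
    ultimately show "DERIV ?Z s :> (\<Sum>n. diffs (?a t) n * (s - t) ^ n)"
      using has_field_derivative_transform_within_open[of "\<lambda>s. \<Sum>n. ?a t n * (s - t) ^ n" _ s "ball t r" ?Z] that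
      by auto
    show "DERIV (\<lambda>s. \<Sum>n. diffs (?a t) n * (s - t) ^ n) s :> (\<Sum>n. diffs (diffs (?a t)) n * (s - t) ^ n)"
      using DERIV_chain'[OF shift termdiffs_strong'[of r "diffs (?a t)", OF summable1 st]] by simp
  qed
  \<comment> \<open>At the center only the constant term of the differentiated series survives, and
    it equals \<open>?a t 1\<close>.\<close>
  have deriv: "DERIV ?Z t :> (\<integral>y. y * exp (t * y) \<partial>m)" if t: "t \<in> I" for t
  proof -
    obtain r where r: "r > 0" "integrable m (\<lambda>y. exp ((t - r) * y))" "integrable m (\<lambda>y. exp ((t + r) * y))" 
      using radius[OF t] by blast
    have "t \<in> ball t r" using r by simp
    from local_series(1)[OF t r(1) this r(2,3)] show ?thesis
      by (simp add: diffs_def)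
  qed
  from deriv[OF \<open>t \<in> I\<close>] show "DERIV ?Z t :> (\<integral>y. y * exp (t * y) \<partial>m)" .
  obtain r where r: "r > 0" "ball t r \<subseteq> I" "integrable m (\<lambda>y. exp ((t - r) * y))" "integrable m (\<lambda>y. exp ((t + r) * y))" 
    using radius[OF \<open>t \<in> I\<close>] by blast
  \<comment> \<open>Every \<open>s\<close> in the ball is also the center of its own expansion, so
    \<open>deriv\<close> holds at \<open>s\<close>; uniqueness of derivatives then identifies the
    series centered at \<open>t\<close> with the integral.\<close>
  have "(\<Sum>n. diffs (?a t) n * (s - t) ^ n) = (\<integral>y. y * exp (s * y) \<partial>m)" if "s \<in> ball t r" for s
    using DERIV_unique[OF local_series(1)[OF \<open>t \<in> I\<close> r(1) that r(3,4)] deriv[of s]] that r by auto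
  with local_series(2)[OF \<open>t \<in> I\<close> r(1) _ r(3,4), of t] 
  have "DERIV (\<lambda>t. \<integral>y. y * exp (t * y) \<partial>m) t :> (\<Sum>n. diffs (diffs (?a t)) n * (t - t) ^ n)"
    using has_field_derivative_transform_within_open[of "\<lambda>s. \<Sum>n. diffs (?a t) n * (s - t) ^ n" _ t "ball t r"
        "\<lambda>t. \<integral>y. y * exp (t * y) \<partial>m"] r(1) by auto
  moreover have "(\<Sum>n. diffs (diffs (?a t)) n * (t - t) ^ n) = 2 * ?a t 2"
    by (simp add: diffs_def numeral_2_eq_2)
  moreover have "2 * ?a t 2 = (\<integral>y. y\<^sup>2 * exp (t * y) \<partial>m)"
    by (subst integral_mult_right_zero[symmetric]) (simp add: mult_ac)
  ultimately show "DERIV (\<lambda>t. \<integral>y. y * exp (t * y) \<partial>m) t :> (\<integral>y. y\<^sup>2 * exp (t * y) \<partial>m)"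
    by simp
  \<comment> \<open>The power series term at \<open>h = r\<close> is a nonzero multiple of the
    integrand sought.\<close>
  have "integrable m (\<lambda>y. fact k / r ^ k * ((r * y) ^ k /\<^sub>R fact k * exp (t * y)))"
    using laplace_transform_power_series(1)[OF sets r(3,4), of r] r(1)
    by (intro integrable_mult_right) simp
  then show "integrable m (\<lambda>y. y ^ k * exp (t * y))"
    using r(1) by (simp add: power_mult_distrib)
qed

lemma exponential_family_log_partition:
  assumes fam: "exponential_family m I" and t: "t \<in> I"
  shows "DERIV (log_partition m) t :> deriv (log_partition m) t"
    and "DERIV (deriv (log_partition m)) t :> deriv (deriv (log_partition m)) t"
    and "deriv (deriv (log_partition m)) t \<ge> 0"
proof -
  let ?Z = "\<lambda>t. \<integral>y. exp (t * y) \<partial>m"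
  let ?Z' = "\<lambda>t. \<integral>y. y * exp (t * y) \<partial>m"
  let ?Z'' = "\<lambda>t. \<integral>y. y\<^sup>2 * exp (t * y) \<partial>m"
  from fam have sets[measurable_cong]: "sets m = sets borel" and "open I"
    and ps: "\<And>t. t \<in> I \<Longrightarrow> prob_space (exp_family_dist m t)"
    by (auto simp: exponential_family_def)
  \<comment> \<open>Whatever value \<open>log_partition m t\<close> takes,
    \<open>exp (t * y)\<close> is a positive constant multiple of the density \<open>?p\<close>,
    whose total mass is 1.\<close>
  have int: "integrable m (\<lambda>y. exp (t * y))" and Z_pos: "?Z t > 0" if "t \<in> I" for t
  proof -
    let ?p = "\<lambda>y. exp (t * y - log_partition m t)"
    have "(\<integral>\<^sup>+y. ennreal (?p y) \<partial>m) = emeasure (exp_family_dist m t) (space m)"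
      unfolding exp_family_dist_def by (subst emeasure_density) (auto intro!: nn_integral_cong)
    also have "\<dots> = 1"
      using prob_space.emeasure_space_1[OF ps[OF that]] by (simp add: exp_family_dist_def)
    finally have nn: "(\<integral>\<^sup>+y. ennreal (?p y) \<partial>m) = 1" .
    have int_p: "integrable m ?p"
      by (rule integrableI_nonneg) (auto simp: nn)
    have "(\<integral>y. ?p y \<partial>m) = 1"
      using nn_integral_eq_integral[OF int_p] nn by (simp add: ennreal_eq_1)
    moreover have exp_eq: "exp (t * y) = exp (log_partition m t) * ?p y" for y
      by (simp flip: exp_add)
    ultimately show "?Z t > 0" unfolding exp_eq by simp
    show "integrable m (\<lambda>y. exp (t * y))"
      unfolding exp_eq using int_p by (rule integrable_mult_right)
  qed
  note Z = laplace_transform_derivatives[OF sets \<open>open I\<close> int]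
  have D1: "DERIV (log_partition m) t :> ?Z' t / ?Z t" if "t \<in> I" for t
    unfolding log_partition_def[abs_def]
    by (auto intro!: derivative_eq_intros Z(2) that Z_pos simp: field_simps)
  hence deriv1: "deriv (log_partition m) t = ?Z' t / ?Z t" if "t \<in> I" for t
    using that DERIV_imp_deriv by blast
  with D1[OF t] t show "DERIV (log_partition m) t :> deriv (log_partition m) t" by simp
  have "DERIV (\<lambda>t. ?Z' t / ?Z t) t :> (?Z'' t * ?Z t - ?Z' t * ?Z' t) / (?Z t * ?Z t)"
    using Z_pos[OF t] by (intro DERIV_divide Z t) auto
  hence D2: "DERIV (deriv (log_partition m)) t :> (?Z'' t * ?Z t - ?Z' t * ?Z' t) / (?Z t * ?Z t)"
    by (rule has_field_derivative_transform_within_open[OF _ \<open>open I\<close> t]) (simp add: deriv1)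
  hence deriv2: "deriv (deriv (log_partition m)) t = (?Z'' t * ?Z t - ?Z' t * ?Z' t) / (?Z t * ?Z t)"
    by (rule DERIV_imp_deriv)
  with D2 show "DERIV (deriv (log_partition m)) t :> deriv (deriv (log_partition m)) t" by simp
  txt \<open>The numerator of the second derivative is, up to the factor \<open>?Z t\<close>, an integrated square.\<close>
  have "0 \<le> (\<integral>y. (?Z t * y - ?Z' t)\<^sup>2 * exp (t * y) \<partial>m)"
    by (intro integral_nonneg_AE) simp
  also have "\<dots> = (\<integral>y. (?Z t)\<^sup>2 * (y\<^sup>2 * exp (t * y)) - 2 * ?Z t * ?Z' t * (y * exp (t * y)) + (?Z' t)\<^sup>2 * exp (t * y) \<partial>m)"
    by (intro Bochner_Integration.integral_cong) (auto simp: power2_eq_square algebra_simps)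
  also have "\<dots> = (?Z t)\<^sup>2 * ?Z'' t - 2 * ?Z t * ?Z' t * ?Z' t + (?Z' t)\<^sup>2 * ?Z t"
    using Z(1)[OF _ t, of 1] Z(1)[OF _ t, of 2] int[OF t] by simp
  also have "\<dots> = ?Z t * (?Z'' t * ?Z t - ?Z' t * ?Z' t)"
    by (simp add: algebra_simps power2_eq_square)
  finally have "?Z'' t * ?Z t - ?Z' t * ?Z' t \<ge> 0"
    using Z_pos[OF t] by (simp add: zero_le_mult_iff)
  then show "deriv (deriv (log_partition m)) t \<ge> 0" unfolding deriv2 by simp
qed

section \<open>The scalar inequality that absorbs the penalty\<close>

text \<open>Here \<open>r\<close> stands for the size of the error, and \<open>k\<close>,
  \<open>k'\<close>, \<open>s\<close> for the support sizes of the truth, the estimate and their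
  difference. The penalty factor \<open>3 * A\<^sup>2 / (2 * a)\<close> is the one for which
  \<open>k'\<close> cancels.\<close>

lemma sparse_quadratic_bound:
  fixes A a r s k k' :: real
  assumes "A \<ge> 0" "a > 0" "s \<ge> 0" "k \<ge> 0" "s \<le> k + k'"
    and quad: "A * (sqrt s * r) - a / 2 * r\<^sup>2 \<ge> 3 * A\<^sup>2 / (2 * a) * (k' - k)"
  shows "r \<le> 3 * A / a * sqrt k"
proof -
  \<comment> \<open>The weight 3 bounds \<open>a * A * sqrt s * r\<close> by
    \<open>a\<^sup>2 * r\<^sup>2 / 6 + 3 / 2 * A\<^sup>2 * s\<close>. The second summand matches the
    penalty, and a third of \<open>a\<^sup>2 * r\<^sup>2\<close> remains on the left, whence the
    factor 9 below.\<close>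
  have "0 \<le> (a * r - 3 * (A * sqrt s))\<^sup>2" by simp
  also have "\<dots> = a\<^sup>2 * r\<^sup>2 + 9 * (A\<^sup>2 * s) - 6 * (a * (A * (sqrt s * r)))"
    using \<open>s \<ge> 0\<close> by (simp add: power2_diff power_mult_distrib)
  finally have square: "6 * (a * (A * (sqrt s * r))) \<le> a\<^sup>2 * r\<^sup>2 + 9 * (A\<^sup>2 * s)" by simp
  have "a * (3 * A\<^sup>2 / (2 * a) * (k' - k)) \<le> a * (A * (sqrt s * r) - a / 2 * r\<^sup>2)"
    using quad \<open>a > 0\<close> by (intro mult_left_mono) auto
  moreover have "a * (3 * A\<^sup>2 / (2 * a) * (k' - k)) = 3 / 2 * (A\<^sup>2 * k' - A\<^sup>2 * k)"
    using \<open>a > 0\<close> by (simp add: field_simps)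
  moreover have "a * (A * (sqrt s * r) - a / 2 * r\<^sup>2) = a * (A * (sqrt s * r)) - a\<^sup>2 * r\<^sup>2 / 2"
    by (simp add: algebra_simps power2_eq_square)
  moreover have "A\<^sup>2 * s \<le> A\<^sup>2 * k + A\<^sup>2 * k'"
    using mult_left_mono[OF \<open>s \<le> k + k'\<close>, of "A\<^sup>2"] by (simp add: distrib_left)
  ultimately have "a\<^sup>2 * r\<^sup>2 \<le> 9 * (A\<^sup>2 * k)" using square by argo
  hence "(a * r)\<^sup>2 \<le> (3 * A * sqrt k)\<^sup>2" using \<open>k \<ge> 0\<close> by (simp add: power_mult_distrib)
  hence "a * r \<le> 3 * A * sqrt k"
    by (rule power2_le_imp_le) (use \<open>A \<ge> 0\<close> \<open>k \<ge> 0\<close> in simp)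
  then show ?thesis using \<open>a > 0\<close> by (simp add: field_simps)
qed

section \<open>Coherence and the action of the matrix on sparse vectors\<close>

text \<open>Expand the squared norm over the Gram matrix, bound its off-diagonal entries below by
  coherence, and apply Cauchy-Schwarz on the support of \<open>h\<close>.\<close>

lemma norm_matrix_vector_mult_ge:
  fixes X :: "real ^ 'p::finite ^ 'n::finite" and \<mu> :: real
  assumes \<mu>: "\<mu> \<ge> 0"
    and coh: "\<And>i j. i \<noteq> j \<Longrightarrow> \<bar>column i X \<bullet> column j X\<bar> \<le> \<mu> * (norm (column i X) * norm (column j X))"
  shows "(norm (X *v h))\<^sup>2 \<ge> (1 + \<mu> - \<mu> * card (spt h)) * (\<Sum>j\<in>UNIV. (h $ j)\<^sup>2 * (norm (column j X))\<^sup>2)"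
proof -
  define w where "w j = \<bar>h $ j\<bar> * norm (column j X)" for j
  have X: "X *v h = (\<Sum>j\<in>UNIV. h $ j *\<^sub>R column j X)"
    by (simp add: matrix_mult_sum scalar_mult_eq_scaleR)
  \<comment> \<open>On the diagonal this is an equality: \<open>\<mu> * (w i)\<^sup>2\<close> is
    added and subtracted so that the subtracted terms add up to a full square.\<close>
  have pointwise: "(h $ i * h $ j) * (column i X \<bullet> column j X)
      \<ge> (if i = j then (1 + \<mu>) * (w i)\<^sup>2 else 0) - \<mu> * (w i * w j)" for i j
  proof (cases "i = j")
    case True
    then show ?thesis
      by (simp add: w_def power_mult_distrib power2_norm_eq_inner algebra_simps flip: power2_eq_square)
  next
    case False
    have "\<bar>(h $ i * h $ j) * (column i X \<bullet> column j X)\<bar> 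
       \<le> \<bar>h $ i * h $ j\<bar> * (\<mu> * (norm (column i X) * norm (column j X)))"
      unfolding abs_mult[of "h $ i * h $ j"] by (intro mult_left_mono coh False) simp
    hence "- (\<bar>h $ i * h $ j\<bar> * (\<mu> * (norm (column i X) * norm (column j X))))
        \<le> (h $ i * h $ j) * (column i X \<bullet> column j X)"
      by linarith
    then show ?thesis using False by (simp add: w_def abs_mult mult_ac)
  qed
  have square_sum: "(\<Sum>j\<in>UNIV. w j)\<^sup>2 = (\<Sum>i\<in>UNIV. \<Sum>j\<in>UNIV. w i * w j)"
    by (simp add: power2_eq_square sum_product)
  have "(\<Sum>j\<in>UNIV. w j) = (\<Sum>j\<in>spt h. w j)"
    by (intro sum.mono_neutral_right) (auto simp: spt_def w_def)
  hence "(\<Sum>j\<in>UNIV. w j)\<^sup>2 = (\<Sum>j\<in>spt h. w j)\<^sup>2" by simp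
  also have "\<dots> \<le> (\<Sum>j\<in>spt h. (w j)\<^sup>2) * card (spt h)"
    using Cauchy_Schwarz_ineq_sum[of w "\<lambda>_. 1" "spt h"] by simp
  also have "(\<Sum>j\<in>spt h. (w j)\<^sup>2) = (\<Sum>j\<in>UNIV. (w j)\<^sup>2)"
    by (intro sum.mono_neutral_left) (auto simp: spt_def w_def)
  finally have "\<mu> * (\<Sum>j\<in>UNIV. w j)\<^sup>2 \<le> \<mu> * ((\<Sum>j\<in>UNIV. (w j)\<^sup>2) * card (spt h))"
    using \<mu> by (rule mult_left_mono)
  moreover have "(1 + \<mu>) * (\<Sum>j\<in>UNIV. (w j)\<^sup>2) - \<mu> * (\<Sum>j\<in>UNIV. w j)\<^sup>2
     = (\<Sum>i\<in>UNIV. \<Sum>j\<in>UNIV. (if i = j then (1 + \<mu>) * (w i)\<^sup>2 else 0) - \<mu> * (w i * w j))"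
    unfolding square_sum by (simp add: sum_subtractf sum_distrib_left)
  moreover have "\<dots> \<le> (\<Sum>i\<in>UNIV. \<Sum>j\<in>UNIV. (h $ i * h $ j) * (column i X \<bullet> column j X))"
    by (intro sum_mono pointwise)
  moreover have "\<dots> = (norm (X *v h))\<^sup>2"
    unfolding X power2_norm_eq_inner
    by (simp add: inner_sum_left inner_sum_right sum_distrib_left inner_commute mult_ac)
  ultimately have "(norm (X *v h))\<^sup>2 \<ge> (1 + \<mu> - \<mu> * card (spt h)) * (\<Sum>j\<in>UNIV. (w j)\<^sup>2)"
    by (simp add: algebra_simps)
  then show ?thesis by (simp add: w_def power_mult_distrib)
qed

lemma coherence_nonneg: "coherence X \<ge> 0"
  and inner_columns_le_coherence:
    "i \<noteq> j \<Longrightarrow> \<bar>column i X \<bullet> column j X\<bar> \<le> coherence X * (norm (column i X) * norm (column j X))"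
proof -
  let ?f = "\<lambda>(i, j). \<bar>column i X \<bullet> column j X\<bar> / (norm (column i X) * norm (column j X))"
  let ?S = "insert 0 {\<bar>column i X \<bullet> column j X\<bar> / (norm (column i X) * norm (column j X)) | i j. i \<noteq> j}"
  have "?S \<subseteq> insert 0 (range ?f)" by auto
  hence "finite ?S" by (rule finite_subset) simp
  hence bdd: "bdd_above ?S" by (rule bdd_above_finite)
  then show "coherence X \<ge> 0" unfolding coherence_def by (intro cSup_upper) auto
  assume "i \<noteq> j"
  with bdd have *: "?f (i, j) \<le> coherence X" unfolding coherence_def by (intro cSup_upper) auto
  show "\<bar>column i X \<bullet> column j X\<bar> \<le> coherence X * (norm (column i X) * norm (column j X))"
  \<comment> \<open>For a zero column the quotient is 0 by the convention for division and says
    nothing, but both sides of the claim vanish.\<close>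
  proof (cases "norm (column i X) * norm (column j X) = 0")
    case True
    then show ?thesis by auto
  next
    case False
    hence "norm (column i X) * norm (column j X) > 0" by (simp add: zero_less_mult_iff)
    with * show ?thesis by (simp add: divide_le_eq)
  qed
qed

text \<open>Each vector has at most half of n(\<nu>) nonzero entries, so the difference has at most
  n(\<nu>). This turns the factor in \<open>norm_matrix_vector_mult_ge\<close> into a positive one
  when \<open>\<nu> > 0\<close>.\<close>

lemma sparse_domain_diff:
  assumes "u \<in> sparse_domain X I \<nu>" "v \<in> sparse_domain X I \<nu>" "\<nu> \<le> 1"
  shows "\<nu> * (1 + coherence X) \<le> 1 + coherence X - coherence X * card (spt (u - v))"
\<comment> \<open>With coherence 0 the sparsity bound is infinite and restricts nothing; the claim
  is then just \<open>\<nu> \<le> 1\<close>.\<close>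
proof (cases "coherence X = 0")
  case True
  then show ?thesis using assms by simp
next
  case False
  hence pos: "coherence X > 0" using coherence_nonneg[of X] by simp
  have bound: "2 * real (card (spt w)) \<le> (1 - \<nu>) * (1 + 1 / coherence X)" 
    if "w \<in> sparse_domain X I \<nu>" for w
  proof -
    have "ereal (real (card (spt w))) \<le> ereal ((1 - \<nu>) * (1 + 1 / coherence X)) / 2"
      using that False by (simp add: sparse_domain_def sparsity_bound_def)
    also have "\<dots> = ereal ((1 - \<nu>) * (1 + 1 / coherence X) / 2)" 
      by (metis divide_ereal_def ereal_divide numeral_eq_ereal zero_neq_numeral)
    finally show ?thesis by simp
  qed
  have "card (spt (u - v)) \<le> card (spt u \<union> spt v)"
    by (intro card_mono) (auto simp: spt_def)
  also have "\<dots> \<le> card (spt u) + card (spt v)" by (rule card_Un_le)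
  finally have "real (card (spt (u - v))) \<le> (1 - \<nu>) * (1 + 1 / coherence X)"
    using bound[OF assms(1)] bound[OF assms(2)] by simp
  hence "coherence X * card (spt (u - v)) \<le> coherence X * ((1 - \<nu>) * (1 + 1 / coherence X))"
    using pos by (intro mult_left_mono) auto
  also have "\<dots> = (1 - \<nu>) * (1 + coherence X)" using pos by (simp add: field_simps)
  finally show ?thesis by (simp add: algebra_simps)
qed

section \<open>The error bound for a fixed outcome\<close>

lemma power2_norm_vec: "(norm w)\<^sup>2 = (\<Sum>i\<in>UNIV. (w $ i)\<^sup>2)" for w :: "real ^ 'n::finite"
  by (simp add: norm_vec_def L2_set_def sum_nonneg)

text \<open>All randomness is confined to the hypothesis \<open>noise\<close>. The penalty is
  written through \<open>A\<close> and \<open>a\<close> to fit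
  \<open>sparse_quadratic_bound\<close>, and \<open>u\<close> only has to score at least as well as
  \<open>\<beta>\<close>.\<close>

lemma penalized_mle_error_bound:
  fixes X :: "real ^ 'p::finite ^ 'n::finite" and \<beta> u :: "real ^ 'p" and A \<delta> \<nu> v :: real
  defines "a \<equiv> \<nu> * \<delta> * (1 + coherence X) * v"
  assumes family: "exponential_family m I"
    and curvature: "\<And>t. t \<in> I \<Longrightarrow> \<delta> \<le> deriv (deriv (log_partition m)) t" "\<delta> > 0"
    and nu: "0 < \<nu>" "\<nu> \<le> 1"
    and beta: "\<beta> \<in> sparse_domain X I \<nu>" and u: "u \<in> sparse_domain X I \<nu>"
    and columns: "\<And>j. v \<le> (norm (column j X))\<^sup>2" "v > 0"
    and noise: "\<And>j. \<bar>\<Sum>i\<in>UNIV. column j X $ i * (y $ i - deriv (log_partition m) (row i X \<bullet> \<beta>))\<bar> \<le> A"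
    and better: "penalized_loglik m X (3 * A\<^sup>2 / (2 * a)) y \<beta> \<le> penalized_loglik m X (3 * A\<^sup>2 / (2 * a)) y u"
  shows "norm (u - \<beta>) \<le> 3 * A / a * sqrt (card (spt \<beta>))"
proof -
  define h where "h = u - \<beta>"
  define \<epsilon> where "\<epsilon> i = y $ i - deriv (log_partition m) (row i X \<bullet> \<beta>)" for i
  have Xi: "(X *v w) $ i = row i X \<bullet> w" for w i
    by (simp add: matrix_vector_mul_component row_def)
  have y_inner: "y \<bullet> (X *v w) = (\<Sum>i\<in>UNIV. y $ i * (row i X \<bullet> w))" for w
    unfolding inner_vec_def[of y] by (simp add: Xi)
  have Xh: "(X *v h) $ i = row i X \<bullet> u - row i X \<bullet> \<beta>" for i
    by (simp add: Xi h_def inner_diff_right)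
  have "A \<ge> 0" using noise by (meson abs_ge_zero order.trans)
  have "a > 0" using curvature nu columns coherence_nonneg[of X] by (simp add: a_def)

  have "convex I" using family by (simp add: exponential_family_def is_interval_convex_1)
  have in_I: "row i X \<bullet> \<beta> \<in> I" "row i X \<bullet> u \<in> I" for i
    using beta u by (auto simp: sparse_domain_def)
  have gap: "log_partition m (row i X \<bullet> u) - log_partition m (row i X \<bullet> \<beta>)
      \<ge> deriv (log_partition m) (row i X \<bullet> \<beta>) * (X *v h) $ i + \<delta> / 2 * ((X *v h) $ i)\<^sup>2" for i
    unfolding Xh
    by (rule strong_convexity_lower_bound[OF \<open>convex I\<close> exponential_family_log_partition(1,2)[OF family]])
       (use curvature in_I in auto)
  have "3 * A\<^sup>2 / (2 * a) * (real (card (spt u)) - card (spt \<beta>))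
      \<le> (\<Sum>i\<in>UNIV. y $ i * (X *v h) $ i - (log_partition m (row i X \<bullet> u) - log_partition m (row i X \<bullet> \<beta>)))"
    using better
    by (simp add: penalized_loglik_def y_inner Xh sum_subtractf right_diff_distrib)
  also have "\<dots> \<le> (\<Sum>i\<in>UNIV. \<epsilon> i * (X *v h) $ i - \<delta> / 2 * ((X *v h) $ i)\<^sup>2)"
  proof (rule sum_mono)
    fix i
    show "y $ i * (X *v h) $ i - (log_partition m (row i X \<bullet> u) - log_partition m (row i X \<bullet> \<beta>))
        \<le> \<epsilon> i * (X *v h) $ i - \<delta> / 2 * ((X *v h) $ i)\<^sup>2"
      using gap[of i] unfolding \<epsilon>_def left_diff_distrib by linarith
  qed
  also have "\<dots> = (\<Sum>i\<in>UNIV. \<epsilon> i * (X *v h) $ i) - \<delta> / 2 * (norm (X *v h))\<^sup>2"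
    by (simp add: sum_subtractf sum_distrib_left power2_norm_vec)
  finally have basic: "3 * A\<^sup>2 / (2 * a) * (real (card (spt u)) - card (spt \<beta>))
      \<le> (\<Sum>i\<in>UNIV. \<epsilon> i * (X *v h) $ i) - \<delta> / 2 * (norm (X *v h))\<^sup>2" .

  \<comment> \<open>Regrouping by columns exposes the quantities bounded in \<open>noise\<close>;
    the resulting sum of \<open>\<bar>h $ j\<bar>\<close> is then passed to the Euclidean norm by
    Cauchy-Schwarz on the support.\<close>
  have "(\<Sum>i\<in>UNIV. \<epsilon> i * (X *v h) $ i) = (\<Sum>i\<in>UNIV. \<Sum>j\<in>UNIV. h $ j * (column j X $ i * \<epsilon> i))"
    by (simp add: matrix_vector_mult_def column_def sum_distrib_left mult_ac)
  also have "\<dots> = (\<Sum>j\<in>UNIV. h $ j * (\<Sum>i\<in>UNIV. column j X $ i * \<epsilon> i))"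
    by (subst sum.swap) (simp add: sum_distrib_left)
  also have "\<dots> \<le> (\<Sum>j\<in>UNIV. \<bar>h $ j\<bar> * A)"
  proof (rule sum_mono)
    fix j
    have "h $ j * (\<Sum>i\<in>UNIV. column j X $ i * \<epsilon> i) \<le> \<bar>h $ j * (\<Sum>i\<in>UNIV. column j X $ i * \<epsilon> i)\<bar>" 
      by (rule abs_ge_self)
    also have "\<dots> \<le> \<bar>h $ j\<bar> * A"
      unfolding abs_mult \<epsilon>_def by (intro mult_left_mono noise) simp
    finally show "h $ j * (\<Sum>i\<in>UNIV. column j X $ i * \<epsilon> i) \<le> \<bar>h $ j\<bar> * A" .
  qed
  also have "\<dots> = A * (\<Sum>j\<in>UNIV. \<bar>h $ j\<bar>)" by (simp add: sum_distrib_left mult_ac)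
  also have "(\<Sum>j\<in>UNIV. \<bar>h $ j\<bar>) = (\<Sum>j\<in>spt h. \<bar>h $ j\<bar>)"
    by (intro sum.mono_neutral_right) (auto simp: spt_def)
  also have "\<dots> \<le> sqrt (card (spt h)) * norm h"
  proof (rule power2_le_imp_le)
    have "(\<Sum>j\<in>spt h. \<bar>h $ j\<bar>)\<^sup>2 \<le> (\<Sum>j\<in>spt h. \<bar>h $ j\<bar>\<^sup>2) * card (spt h)"
      by (rule sum_squared_le_sum_of_squares)
    also have "(\<Sum>j\<in>spt h. \<bar>h $ j\<bar>\<^sup>2) = (\<Sum>j\<in>UNIV. (h $ j)\<^sup>2)"
      by (intro sum.mono_neutral_cong_left) (auto simp: spt_def)
    also have "\<dots> = (norm h)\<^sup>2" by (simp add: power2_norm_vec)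
    finally show "(\<Sum>j\<in>spt h. \<bar>h $ j\<bar>)\<^sup>2 \<le> (sqrt (card (spt h)) * norm h)\<^sup>2"
      by (simp add: power_mult_distrib mult_ac)
  qed simp
  finally have noise_term: "(\<Sum>i\<in>UNIV. \<epsilon> i * (X *v h) $ i) \<le> A * (sqrt (card (spt h)) * norm h)"
    using \<open>A \<ge> 0\<close> by (simp add: mult_left_mono)

  \<comment> \<open>Sparsity of \<open>h\<close> makes the quadratic term control the norm of
    \<open>h\<close> itself, with constant \<open>a / 2\<close> after scaling by
    \<open>\<delta> / 2\<close>.\<close>
  have "\<nu> * (1 + coherence X) * (v * (norm h)\<^sup>2)
      \<le> (1 + coherence X - coherence X * card (spt h)) * (\<Sum>j\<in>UNIV. (h $ j)\<^sup>2 * (norm (column j X))\<^sup>2)"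
  proof (rule mult_mono')
    show "\<nu> * (1 + coherence X) \<le> 1 + coherence X - coherence X * card (spt h)"
      unfolding h_def by (rule sparse_domain_diff[OF u beta nu(2)])
    have "v * (norm h)\<^sup>2 = (\<Sum>j\<in>UNIV. (h $ j)\<^sup>2 * v)"
      by (simp add: power2_norm_vec sum_distrib_left mult_ac)
    also have "\<dots> \<le> (\<Sum>j\<in>UNIV. (h $ j)\<^sup>2 * (norm (column j X))\<^sup>2)"
      by (intro sum_mono mult_left_mono columns) simp
    finally show "v * (norm h)\<^sup>2 \<le> (\<Sum>j\<in>UNIV. (h $ j)\<^sup>2 * (norm (column j X))\<^sup>2)" .
  qed (use nu columns(2) coherence_nonneg[of X] in auto)
  also have "\<dots> \<le> (norm (X *v h))\<^sup>2"
    by (rule norm_matrix_vector_mult_ge[OF coherence_nonneg inner_columns_le_coherence])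
  finally have "\<delta> / 2 * (\<nu> * (1 + coherence X) * (v * (norm h)\<^sup>2)) \<le> \<delta> / 2 * (norm (X *v h))\<^sup>2"
    using curvature(2) by (intro mult_left_mono) auto
  moreover have "\<delta> / 2 * (\<nu> * (1 + coherence X) * (v * (norm h)\<^sup>2)) = a / 2 * (norm h)\<^sup>2"
    by (simp add: a_def mult_ac)
  ultimately have quad: "A * (sqrt (card (spt h)) * norm h) - a / 2 * (norm h)\<^sup>2
      \<ge> 3 * A\<^sup>2 / (2 * a) * (real (card (spt u)) - card (spt \<beta>))"
    using basic noise_term by linarith

  have "card (spt h) \<le> card (spt \<beta> \<union> spt u)"
    by (intro card_mono) (auto simp: spt_def h_def)
  also have "\<dots> \<le> card (spt \<beta>) + card (spt u)" by (rule card_Un_le)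
  finally have "real (card (spt h)) \<le> real (card (spt \<beta>)) + real (card (spt u))" by linarith
  from sparse_quadratic_bound[OF \<open>A \<ge> 0\<close> \<open>a > 0\<close> _ _ this quad] show ?thesis
    by (simp add: h_def)
qed

section \<open>The noise event, the constants and the probability bound\<close>

theorem theorem3p1:
  fixes X :: "real ^ 'p::finite ^ 'n::finite"
    and m :: "real measure" and I :: "real set"
    and M :: "'a measure" and y :: "'n \<Rightarrow> 'a \<Rightarrow> real" and \<epsilon> :: "'n \<Rightarrow> 'a \<Rightarrow> real"
    and \<beta> :: "real ^ 'p" and \<beta>hat :: "'a \<Rightarrow> real ^ 'p"
    and D :: "(real ^ 'p) set"
    and \<sigma> \<nu> q \<delta> c_r \<kappa>_r :: real
  assumes columns: "\<And>j. column j X \<noteq> 0"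
    and family: "exponential_family m I"
    and prob: "prob_space M"
    and indep: "prob_space.indep_vars M (\<lambda>_. borel) y UNIV"
    and dist: "\<And>i. distr M borel (y i) = exp_family_dist m (row i X \<bullet> \<beta>)"
    and eps: "\<And>i \<omega>. \<epsilon> i \<omega> = y i \<omega> - deriv (log_partition m) (row i X \<bullet> \<beta>)"
    and sigma: "\<sigma> > 0"
    and tail: "\<And>(t::real) (a :: 'n \<Rightarrow> real).
       measure M {\<omega> \<in> space M. (\<Sum>i\<in>UNIV. a i * \<epsilon> i \<omega>)\<^sup>2 > t\<^sup>2 * (\<Sum>i\<in>UNIV. (a i)\<^sup>2)}
         \<le> 2 * exp (- (t\<^sup>2 / (2 * \<sigma>\<^sup>2)))"
    and nu: "0 < \<nu>" "\<nu> < 1"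
    and D: "D = sparse_domain X I \<nu>"
    and delta: "\<delta> = (INF t\<in>I. deriv (deriv (log_partition m)) t)" "\<delta> > 0"
    and q: "0 < q" "q < 1 / 2"
    and c_r: "c_r = 3 * \<sigma>\<^sup>2 * ln (real CARD('p) / q) / (\<nu> * \<delta> * (1 + coherence X))
        * ((MAX j. (norm (column j X))\<^sup>2) / (MIN j. (norm (column j X))\<^sup>2))"
    and measurable: "\<beta>hat \<in> borel_measurable M"
    and argmax: "AE \<omega> in M.
       is_arg_max (penalized_loglik m X c_r (\<chi> i. y i \<omega>)) (\<lambda>u. u \<in> D) (\<beta>hat \<omega>)"
    and kappa_r: "\<kappa>_r = 3 * \<sigma> * sqrt (2 * ln (real CARD('p) / q)) / (\<nu> * \<delta> * (1 + coherence X))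
        * (sqrt (real CARD('n)) * (MAX j. norm (column j X)) / (MIN j. (norm (column j X))\<^sup>2))"
    and beta: "\<beta> \<in> D"
  shows "measure M {\<omega> \<in> space M.
           norm (\<beta>hat \<omega> - \<beta>) \<le> \<kappa>_r * sqrt (real (card (spt \<beta>))) / sqrt (real CARD('n))}
         \<ge> 1 - 2 * q"
proof -
  interpret prob_space M by (rule prob)
  note [measurable] = measurable
  have [measurable]: "random_variable borel (y i)" for i
    using indep by (simp add: indep_vars_def)
  define L where "L = ln (real CARD('p) / q)"
  define vmax where "vmax = (MAX j. norm (column j X))"
  define v where "v = (MIN j. (norm (column j X))\<^sup>2)"
  \<comment> \<open>Chosen so that the tail bound for one column is \<open>2 * exp (- L)\<close>,
    that is, 2q/p.\<close>
  define t where "t = \<sigma> * sqrt (2 * L)"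
  define a where "a = \<nu> * \<delta> * (1 + coherence X) * v"
  define E where "E j = {\<omega> \<in> space M. (\<Sum>i\<in>UNIV. column j X $ i * \<epsilon> i \<omega>)\<^sup>2 > t\<^sup>2 * (\<Sum>i\<in>UNIV. (column j X $ i)\<^sup>2)}" for j
  let ?G = "{\<omega> \<in> space M. norm (\<beta>hat \<omega> - \<beta>) \<le> \<kappa>_r * sqrt (real (card (spt \<beta>))) / sqrt (real CARD('n))}"

  \<comment> \<open>The logarithm must be nonnegative for the square root in \<open>t\<close> to
    square back to \<open>2 * L\<close>.\<close>
  have "1 \<le> real CARD('p)" by (simp add: Suc_le_eq)
  hence "q \<le> real CARD('p)" using q by linarith
  hence "1 \<le> real CARD('p) / q" using q by (simp add: le_divide_eq)
  hence L: "L \<ge> 0" by (simp add: L_def)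
  hence t: "t \<ge> 0" "t\<^sup>2 = 2 * \<sigma>\<^sup>2 * L" using sigma by (simp_all add: t_def power_mult_distrib)
  have le_vmax: "norm (column j X) \<le> vmax" for j unfolding vmax_def by (intro Max_ge) auto
  have v_le: "v \<le> (norm (column j X))\<^sup>2" for j unfolding v_def by (intro Min_le) auto
  have "v \<in> range (\<lambda>j. (norm (column j X))\<^sup>2)" unfolding v_def by (intro Min_in) auto
  with columns have "v > 0" by auto
  have vmax2: "(MAX j. (norm (column j X))\<^sup>2) = vmax\<^sup>2"
  proof (rule Max_eqI)
    have "vmax \<in> range (\<lambda>j. norm (column j X))" unfolding vmax_def by (intro Max_in) auto
    then show "vmax\<^sup>2 \<in> range (\<lambda>j. (norm (column j X))\<^sup>2)" by auto
  qed (auto intro: power_mono le_vmax)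
  \<comment> \<open>With \<open>A = t * vmax\<close> the prescribed penalty is exactly the one in
    \<open>penalized_mle_error_bound\<close>; \<open>kappa_eq\<close> does the same for the radius,
    where the two factors \<open>sqrt (real CARD('n))\<close> cancel.\<close>
  have c_r_eq: "c_r = 3 * (t * vmax)\<^sup>2 / (2 * (\<nu> * \<delta> * (1 + coherence X) * v))"
  proof -
    have "3 * \<sigma>\<^sup>2 * L / d * (vmax\<^sup>2 / v) = 3 * (t * vmax)\<^sup>2 / (2 * (d * v))" for d
      by (simp add: power_mult_distrib t(2))
    then show ?thesis by (simp add: c_r vmax2 flip: L_def v_def)
  qed
  have kappa_eq: "\<kappa>_r * s / sqrt (real CARD('n)) = 3 * (t * vmax) / (\<nu> * \<delta> * (1 + coherence X) * v) * s" for s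
  proof -
    have "3 * \<sigma> * sqrt (2 * L) / d * (sqrt (real CARD('n)) * vmax / v) * s / sqrt (real CARD('n))
        = 3 * (t * vmax) / (d * v) * s" for d
      by (simp add: t_def)
    then show ?thesis unfolding kappa_r L_def[symmetric] v_def[symmetric] vmax_def[symmetric] .
  qed

  \<comment> \<open>A real infimum is a lower bound only for a set bounded below; nonnegativity of
    the second derivative supplies the bound 0.\<close>
  have "bdd_below ((\<lambda>t. deriv (deriv (log_partition m)) t) ` I)"
    using exponential_family_log_partition(3)[OF family] by (intro bdd_belowI2)
  hence curvature: "\<delta> \<le> deriv (deriv (log_partition m)) t" if "t \<in> I" for t
    unfolding delta(1) using that by (rule cINF_lower)

  \<comment> \<open>The estimator is a maximizer only almost surely, so the inclusion of events
    holds up to a null set.\<close>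
  have "AE \<omega> in M. \<omega> \<in> space M - (\<Union>j. E j) \<longrightarrow> \<omega> \<in> ?G"
    using argmax
  proof eventually_elim
    case (elim \<omega>)
    show ?case
    proof
      assume \<omega>: "\<omega> \<in> space M - (\<Union>j. E j)"
      have noise: "\<bar>\<Sum>i\<in>UNIV. column j X $ i * \<epsilon> i \<omega>\<bar> \<le> t * vmax" for j
      proof -
        have "(\<Sum>i\<in>UNIV. column j X $ i * \<epsilon> i \<omega>)\<^sup>2 \<le> t\<^sup>2 * (\<Sum>i\<in>UNIV. (column j X $ i)\<^sup>2)"
          using \<omega> by (auto simp: E_def not_less)
        also have "\<dots> = (t * norm (column j X))\<^sup>2"
          by (simp add: power_mult_distrib power2_norm_vec)
        finally have "\<bar>\<Sum>i\<in>UNIV. column j X $ i * \<epsilon> i \<omega>\<bar> \<le> t * norm (column j X)"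
          using t by (simp add: abs_le_square_iff[symmetric])
        also have "\<dots> \<le> t * vmax" by (intro mult_left_mono le_vmax t)
        finally show ?thesis .
      qed
      from elim have hat: "\<beta>hat \<omega> \<in> D"
        and max: "penalized_loglik m X c_r (\<chi> i. y i \<omega>) \<beta> \<le> penalized_loglik m X c_r (\<chi> i. y i \<omega>) (\<beta>hat \<omega>)"
        using beta by (auto simp: is_arg_max_def not_less)
      have "norm (\<beta>hat \<omega> - \<beta>) \<le> 3 * (t * vmax) / (\<nu> * \<delta> * (1 + coherence X) * v) * sqrt (card (spt \<beta>))"
        by (rule penalized_mle_error_bound[OF family curvature delta(2) nu(1) less_imp_le[OF nu(2)]
              beta[unfolded D] hat[unfolded D] v_le \<open>v > 0\<close> _ max[unfolded c_r_eq]])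
           (use noise in \<open>simp_all add: eps\<close>)
      with \<omega> show "\<omega> \<in> ?G" by (simp add: kappa_eq)
    qed
  qed
  moreover have [measurable]: "E j \<in> events" for j
    unfolding E_def eps by measurable
  moreover have "?G \<in> events" by measurable
  ultimately have "prob (space M - (\<Union>j. E j)) \<le> prob ?G"
    by (intro finite_measure_mono_AE) auto
  moreover have "prob (space M - (\<Union>j. E j)) = 1 - prob (\<Union>j. E j)"
    by (rule prob_compl) measurable
  moreover have "prob (\<Union>j. E j) \<le> 2 * q"
  proof -
    \<comment> \<open>Union bound over the columns; the tail assumption is applied with the entries
      of column \<open>j\<close> as coefficients.\<close>
    have "prob (\<Union>j. E j) \<le> (\<Sum>j\<in>UNIV. prob (E j))"
      by (intro finite_measure_subadditive_finite) auto
    also have "\<dots> \<le> (\<Sum>j\<in>(UNIV :: 'p set). 2 * exp (- L))"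
    proof (rule sum_mono)
      fix j
      have "t\<^sup>2 / (2 * \<sigma>\<^sup>2) = L" using sigma by (simp add: t(2))
      then show "prob (E j) \<le> 2 * exp (- L)" unfolding E_def using tail[of t "\<lambda>i. column j X $ i"] by simp
    qed
    also have "\<dots> = 2 * q" using q by (simp add: L_def exp_minus)
    finally show ?thesis .
  qed
  ultimately show ?thesis by linarith
qed

end
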